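(* The graph $G$ defined as follows has no $(1,2^4,7)$-packing edge-coloring. Let $L$ be the graph on vertices $x_1,\dots,x_8$ with edges $x_1x_2, x_1x_3, x_2x_3, x_2x_4, x_3x_5, x_4x_5, x_4x_6, x_5x_7, x_6x_7, x_6x_8, x_7x_8$. Let $G_0$ be the gadget consisting of a vertex $v$ and two disjoint copies of $L$, on $\{v_1,\dots,v_8\}$ and $\{v_1',\dots,v_8'\}$ (with $v_i$, $v_i'$ in the role of $x_i$), together with the edges $vv_1$ and $vv_1'$. Let $G_0'$ and $G_0''$ be disjoint copies of $G_0$, in which the vertices $v'$ and $v''$, respectively, correspond to $v$. Then $G$ consists of a vertex $u$, three disjoint copies of $L$ on $\{u_1,\dots,u_8\}$, $\{u_1',\dots,u_8'\}$, $\{u_1'',\dots,u_8''\}$ (with $u_i,u_i',u_i''$ in the role of $x_i$), and the gadgets $G_0$, $G_0'$, $G_0''$, together with the edges $uu_1$, $uu_1'$, $uu_1''$, $u_8v$, $u_8'v'$, $u_8''v''$.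
   Context: The graph $G$ is subcubic (maximum degree at most $3$) and outerplanar. The distance between two distinct edges of a graph is their distance in its line graph, so edges sharing an endpoint are at distance $1$. For a non-decreasing sequence $S=(s_1,\dots,s_k)$ of positive integers, an $S$-packing edge-coloring of a graph $H$ is a partition of $E(H)$ into (possibly empty) classes $E_1,\dots,E_k$ such that, for each $i$, any two distinct edges in $E_i$ are at distance at least $s_i+1$. Exponents denote repetition: $(1,2^4,7)=(1,2,2,2,2,7)$. *)

theory Defs
  imports Main "HOL-Library.Extended_Nat" "HOL-Library.Disjoint_Sets"
begin

record 'a graph =
  verts :: "'a set"
  edges :: "'a set set"

definition simple_graph :: "'a graph \<Rightarrow> bool" where
  "simple_graph H \<longleftrightarrow> (\<forall>e \<in> edges H. e \<subseteq> verts H \<and> card e = 2)"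

definition adjacency :: "'a graph \<Rightarrow> 'a rel" where
  "adjacency H = {(x, y). {x, y} \<in> edges H}"

(* The n-fold composition of the adjacency relation relates the ends of walks
   of length n; the distance is infinite when there is no walk. *)
definition graph_dist :: "'a graph \<Rightarrow> 'a \<Rightarrow> 'a \<Rightarrow> enat" where
  "graph_dist H x y = (INF n \<in> {n. (x, y) \<in> adjacency H ^^ n}. enat n)"

definition line_graph :: "'a graph \<Rightarrow> 'a set graph" where
  "line_graph H = \<lparr> verts = edges H,
     edges = {{e, f} | e f. e \<in> edges H \<and> f \<in> edges H \<and> e \<noteq> f \<and> e \<inter> f \<noteq> {}} \<rparr>"

(* The i-th class, for i < length S, is C i; classes may be empty. *)
definition packing_edge_coloring ::
    "nat list \<Rightarrow> 'a graph \<Rightarrow> (nat \<Rightarrow> 'a set set) \<Rightarrow> bool" where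
  "packing_edge_coloring S H C \<longleftrightarrow>
     (\<Union>i < length S. C i) = edges H \<and>
     disjoint_family_on C {..<length S} \<and>
     (\<forall>i < length S. \<forall>e \<in> C i. \<forall>f \<in> C i. e \<noteq> f \<longrightarrow>
        enat (S ! i + 1) \<le> graph_dist (line_graph H) e f)"

datatype xvert = X1 | X2 | X3 | X4 | X5 | X6 | X7 | X8

definition L_graph :: "xvert graph" where
  "L_graph = \<lparr> verts = UNIV,
     edges = {{X1, X2}, {X1, X3}, {X2, X3}, {X2, X4}, {X3, X5}, {X4, X5},
              {X4, X6}, {X5, X7}, {X6, X7}, {X6, X8}, {X7, X8}} \<rparr>"

(* Superscripts: Plain, Prime, Second stand for no prime, one prime, two primes. *)
datatype copy2 = Plain2 | Prime2
datatype copy3 = Plain | Prime | Second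

(* V is the vertex v; VL Plain2 and VL Prime2 embed the two copies of L,
   on the v_i and on the v_i'. *)
datatype gadget_vert = V | VL copy2 xvert

definition gadget_graph :: "gadget_vert graph" where
  "gadget_graph = \<lparr> verts = UNIV,
     edges = (\<Union>b. (`) (VL b) ` edges L_graph) \<union> {{V, VL b X1} | b. True} \<rparr>"

(* UL c embeds the copy of L on the u_i (with superscript c), and GV c the
   corresponding copy of the gadget, so that GV c V is v, v' or v''. *)
datatype vert = U | UL copy3 xvert | GV copy3 gadget_vert

definition G_graph :: "vert graph" where
  "G_graph = \<lparr> verts = UNIV,
     edges = (\<Union>c. (`) (UL c) ` edges L_graph) \<union>
             (\<Union>c. (`) (GV c) ` edges gadget_graph) \<union>
             {{U, UL c X1} | c. True} \<union>
             {{UL c X8, GV c V} | c. True} \<rparr>"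

lemma simple_graph_G: "simple_graph G_graph"
  unfolding simple_graph_def
  by (auto simp: G_graph_def gadget_graph_def L_graph_def)

end

theory Submission
  imports Defs
begin

text \<open>
  The distances between edges are measured in the line graph. If a copy of \<open>L\<close> and a pendant edge
  at its vertex \<open>x\<^sub>1\<close> contain no edge of the 7-class, then the pendant edge is in the 1-class: six
  edges around the triangle \<open>x\<^sub>1x\<^sub>2x\<^sub>3\<close> are pairwise at distance at most two, so four 2-classes leave
  two of them to the 1-class, and if the pendant edge is not one of them, the coloring does not
  extend to the other triangle.
  Edges of the 1-class do not meet, so at \<open>u\<close> two of the three branches contain an edge of the
  7-class. Those two edges are at distance at least 8, which pushes one of them, \<open>e\<close>, into the
  triangle \<open>x\<^sub>6x\<^sub>7x\<^sub>8\<close> of its branch. But one of the two branches at the gadget vertex behind \<open>e\<close> also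
  contains an edge of the 7-class, and its distance to \<open>e\<close> is at most 7.
\<close>

section \<open>Distances\<close>

lemma graph_dist_le: "(x, y) \<in> adjacency H ^^ n \<Longrightarrow> graph_dist H x y \<le> enat n"
  unfolding graph_dist_def by (rule INF_lower) simp

lemma graph_dist_leE:
  assumes "graph_dist H x y \<le> enat n"
  obtains m where "m \<le> n" "(x, y) \<in> adjacency H ^^ m"
proof -
  \<comment> \<open>A strict bound on the infimum is what \<open>INF_less_iff\<close> needs to
    supply an actual walk length.\<close>
  have "graph_dist H x y < enat (Suc n)"
    using assms by (rule order.strict_trans1) simp
  then show thesis
    unfolding graph_dist_def INF_less_iff by (auto simp: less_Suc_eq_le intro: that)
qed

lemma graph_dist_triangle_le:
  assumes "graph_dist H x y \<le> enat m" "graph_dist H y z \<le> enat n"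
  shows "graph_dist H x z \<le> enat (m + n)"
proof -
  obtain m' n' where *: "m' \<le> m" "n' \<le> n"
      "(x, y) \<in> adjacency H ^^ m'" "(y, z) \<in> adjacency H ^^ n'"
    using assms by (metis graph_dist_leE)
  then have "(x, z) \<in> adjacency H ^^ (m' + n')"
    unfolding relpow_add by blast
  then have "graph_dist H x z \<le> enat (m' + n')"
    by (rule graph_dist_le)
  also have "\<dots> \<le> enat (m + n)"
    using * by simp
  finally show ?thesis .
qed

lemma relpow_adjacency_sym: "(x, y) \<in> adjacency H ^^ n \<Longrightarrow> (y, x) \<in> adjacency H ^^ n"
proof (induction n arbitrary: y)
  case (Suc n)
  then obtain z where "(x, z) \<in> adjacency H ^^ n" "(z, y) \<in> adjacency H"
    by auto
  moreover from this have "(y, z) \<in> adjacency H"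
    by (simp add: adjacency_def insert_commute)
  ultimately show ?case
    using Suc.IH relpow_Suc_I2 by metis
qed simp

lemma graph_dist_commute: "graph_dist H x y = graph_dist H y x"
proof -
  have "{n. (x, y) \<in> adjacency H ^^ n} = {n. (y, x) \<in> adjacency H ^^ n}"
    by (auto intro: relpow_adjacency_sym)
  then show ?thesis
    unfolding graph_dist_def by simp
qed

abbreviation edge_dist :: "'a graph \<Rightarrow> 'a set \<Rightarrow> 'a set \<Rightarrow> enat" where
  "edge_dist H \<equiv> graph_dist (line_graph H)"

lemma edge_dist_meet:
  assumes "e \<in> edges H" "f \<in> edges H" "e \<inter> f \<noteq> {}"
  shows "edge_dist H e f \<le> enat (Suc 0)"
proof (cases "e = f")
  case True
  then have "edge_dist H e f \<le> enat 0"
    by (intro graph_dist_le) simp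
  then show ?thesis
    by (rule order_trans) simp
next
  case False
  then have "(e, f) \<in> adjacency (line_graph H) ^^ Suc 0"
    using assms by (auto simp: adjacency_def line_graph_def)
  then show ?thesis
    by (rule graph_dist_le)
qed

lemma edge_dist_step:
  assumes "edge_dist H e f \<le> enat n" "f \<in> edges H" "g \<in> edges H" "f \<inter> g \<noteq> {}"
  shows "edge_dist H e g \<le> enat (Suc n)"
  using graph_dist_triangle_le[OF assms(1) edge_dist_meet[OF assms(2-4)]] by simp

text \<open>Go from \<open>e\<close> to \<open>p\<close>, step to \<open>q\<close>, continue to
  \<open>f\<close>. This serves both for two branches whose pendant edges meet and for the passage
  from a branch at \<open>U\<close> into the gadget behind it.\<close>

lemma edge_dist_bridge:
  assumes "edge_dist H p e \<le> enat m" "edge_dist H q f \<le> enat n"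
    and "p \<in> edges H" "q \<in> edges H" "p \<inter> q \<noteq> {}"
  shows "edge_dist H e f \<le> enat (Suc m + n)"
proof -
  have "edge_dist H e p \<le> enat m"
    using assms(1) by (simp add: graph_dist_commute)
  from edge_dist_step[OF this assms(3-5)] assms(2) show ?thesis
    by (rule graph_dist_triangle_le)
qed

section \<open>Colorings of a copy of L with a pendant edge\<close>

text \<open>Pigeonhole. Once four edges use up the four nonzero colors, the color of any further
  edge is found by elimination.\<close>

lemma remaining_color:
  fixes a b c d x :: nat
  assumes "distinct [0, a, b, c, d]" "a < 5" "b < 5" "c < 5" "d < 5" "x < 5"
  shows "x \<in> {0, a, b, c, d}"
proof -
  have "card {0, a, b, c, d} = card {..<5::nat}"
    using assms(1) by simp
  then have "{0, a, b, c, d} = {..<5}"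
    using assms by (intro card_subset_eq) auto
  then show ?thesis
    using assms by blast
qed

text \<open>The color 0 is that of the 1-class; the color 5, excluded by the bounds below 5, is
  that of the 7-class.\<close>

definition compat :: "nat \<Rightarrow> nat \<Rightarrow> bool" where
  "compat x y \<longleftrightarrow> x \<noteq> y \<or> x = 0"

text \<open>Here \<open>p\<close> is the color of the pendant edge and \<open>aij\<close> that of
  the edge joining \<open>Xi\<close> and \<open>Xj\<close>; \<open>compat\<close> is the condition
  for edges at distance two. Elimination forces the colors one by one until \<open>a67\<close> and
  \<open>a68\<close>, which belong to edges that meet, are both \<open>a23\<close>.\<close>

lemma no_coloring_12_35:
  fixes p a13 a23 a24 a35 a45 a46 a57 a67 a68 :: nat
  assumes "p < 5" "a13 < 5" "a23 < 5" "a24 < 5" "a45 < 5" "a46 < 5" "a57 < 5" "a67 < 5" "a68 < 5"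
    and "a35 = 0"
    and "distinct [0, p, a13, a23, a24]"
    and "a45 \<noteq> a35" "a45 \<noteq> a24" "compat a45 a23" "compat a45 a13"
    and "a57 \<noteq> a35" "a57 \<noteq> a45" "compat a57 a23" "compat a57 a24"
    and "a46 \<noteq> a24" "a46 \<noteq> a45" "compat a46 a23" "compat a46 a57"
    and "a67 \<noteq> a46" "a67 \<noteq> a57" "compat a67 a45" "compat a67 a24"
    and "a68 \<noteq> a46" "a68 \<noteq> a67" "compat a68 a45" "compat a68 a57" "compat a68 a24"
  shows False
proof -
  have pick: "x \<in> {0, p, a13, a23, a24}" if "x < 5" for x
    using remaining_color[of p a13 a23 a24 x] assms that by blast
  have 45: "a45 = p"
    using pick[of a45] assms by (auto simp: compat_def)
  have 57: "a57 = a13"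
    using pick[of a57] 45 assms by (auto simp: compat_def)
  have 46: "a46 = 0"
    using pick[of a46] 45 57 assms by (auto simp: compat_def)
  have "a67 = a23"
    using pick[of a67] 45 46 57 assms by (auto simp: compat_def)
  moreover have "a68 = a23"
    using pick[of a68] 45 46 57 assms by (auto simp: compat_def)
  ultimately show False
    using assms by simp
qed

text \<open>First \<open>a45 = p\<close>, and then \<open>a46\<close> and \<open>a57\<close> take up
  \<open>a12\<close> and \<open>a13\<close> in some order. For the three mutually adjacent edges of
  the far triangle only the two colors 0 and \<open>a23\<close> are left.\<close>

lemma no_coloring_24_35:
  fixes p a12 a13 a23 a24 a35 a45 a46 a57 a67 a68 a78 :: nat
  assumes "p < 5" "a12 < 5" "a13 < 5" "a23 < 5" "a45 < 5" "a46 < 5" "a57 < 5"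
      "a67 < 5" "a68 < 5" "a78 < 5"
    and "a24 = 0" "a35 = 0"
    and "distinct [0, p, a12, a13, a23]"
    and "a45 \<noteq> a35" "compat a45 a12" "compat a45 a13" "compat a45 a23"
    and "a46 \<noteq> a24" "a46 \<noteq> a45" "compat a46 a23" "compat a46 a57"
    and "a57 \<noteq> a35" "a57 \<noteq> a45" "compat a57 a23"
    and "a67 \<noteq> a46" "a67 \<noteq> a57" "compat a67 a45"
    and "a68 \<noteq> a46" "a68 \<noteq> a67" "compat a68 a45" "compat a68 a57"
    and "a78 \<noteq> a57" "a78 \<noteq> a67" "a78 \<noteq> a68" "compat a78 a45" "compat a78 a46"
  shows False
proof -
  have pick: "x \<in> {0, p, a12, a13, a23}" if "x < 5" for x
    using remaining_color[of p a12 a13 a23 x] assms that by blast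
  have 45: "a45 = p"
    using pick[of a45] assms by (auto simp: compat_def)
  have 46: "a46 = a12 \<or> a46 = a13" and 57: "a57 = a12 \<or> a57 = a13" and "a46 \<noteq> a57"
    using pick[of a46] pick[of a57] 45 assms by (auto simp: compat_def)
  then have *: "{a46, a57} = {a12, a13}"
    by auto
  have *: "x = 0 \<or> x = a23" if "x < 5" "compat x a45" "compat x a46" "compat x a57" for x
    using pick[OF that(1)] that 45 * by (auto simp: compat_def doubleton_eq_iff)
  have "a67 = 0 \<or> a67 = a23" "a68 = 0 \<or> a68 = a23" "a78 = 0 \<or> a78 = a23"
    by (rule *; use assms in \<open>simp add: compat_def\<close>)+
  with \<open>a68 \<noteq> a67\<close> \<open>a78 \<noteq> a67\<close> \<open>a78 \<noteq> a68\<close> show False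
    by metis
qed

text \<open>Six edges pairwise at distance at most two cannot repeat a nonzero color, so at least
  two have color 0, and \<open>p\<close> is not among them. Edges of color 0 are disjoint, and the
  other five edges contain only three disjoint pairs, which are the three cases.\<close>

lemma two_zeros:
  fixes p a12 a13 a23 a24 a35 :: nat
  assumes "p < 5" "a12 < 5" "a13 < 5" "a23 < 5" "a24 < 5" "a35 < 5"
    and "p \<noteq> 0" "p \<noteq> a12" "p \<noteq> a13" "compat p a23" "compat p a24" "compat p a35"
    and "a12 \<noteq> a13" "a12 \<noteq> a23" "a12 \<noteq> a24" "compat a12 a35"
    and "a13 \<noteq> a23" "compat a13 a24" "a13 \<noteq> a35"
    and "a23 \<noteq> a24" "a23 \<noteq> a35" "compat a24 a35"
  obtains (12) "a12 = 0" "a35 = 0" "distinct [0, p, a13, a23, a24]"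
    | (13) "a13 = 0" "a24 = 0" "distinct [0, p, a12, a23, a35]"
    | (24) "a24 = 0" "a35 = 0" "distinct [0, p, a12, a13, a23]"
proof -
  have full: "\<not> distinct [0, p, x, y, z, w]" if "x < 5" "y < 5" "z < 5" "w < 5" for x y z w
    using remaining_color[of p x y z w] that assms(1) by auto
  note D = assms(7-)[unfolded compat_def]
  consider "a12 = 0" | "a12 \<noteq> 0" "a13 = 0" | "a12 \<noteq> 0" "a13 \<noteq> 0"
    by blast
  then show thesis
  proof cases
    case 1
    with D have "distinct [0, p, a13, a23, a24]"
      by auto
    moreover from this have "a35 = 0"
      using full[OF assms(3-6)] D 1 by auto
    ultimately show thesis
      using 12 1 by blast
  next
    case 2
    with D have "distinct [0, p, a12, a23, a35]"
      by auto
    moreover from this have "a24 = 0"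
      using full[OF assms(2,4,5,6)] D 2 by auto
    ultimately show thesis
      using 13 2 by blast
  next
    case 3
    \<comment> \<open>If \<open>a23\<close> were 0, then \<open>a24\<close> and \<open>a35\<close>
      would not be, and \<open>p\<close>, \<open>a12\<close>, \<open>a13\<close>,
      \<open>a24\<close>, \<open>a35\<close> would be five distinct nonzero colors below 5.\<close>
    have "a23 \<noteq> 0"
      using full[OF assms(2,3,5,6)] D 3 by auto
    with D 3 have *: "distinct [0, p, a12, a13, a23]"
      by auto
    moreover have "a24 = 0" "a35 = 0"
      using full[OF assms(2,3,4,5)] full[OF assms(2,3,4,6)] * D by auto
    ultimately show thesis
      using 24 by blast
  qed
qed

section \<open>Packing colorings as functions from edges to class indices\<close>

locale packing_147 =
  fixes H :: "'a graph" and col :: "'a set \<Rightarrow> nat"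
  assumes col_less: "e \<in> edges H \<Longrightarrow> col e < 6"
    and col_dist: "\<lbrakk>e \<in> edges H; f \<in> edges H; e \<noteq> f; col e = col f\<rbrakk>
      \<Longrightarrow> enat (([1] @ replicate 4 2 @ [7]) ! col e + 1) \<le> edge_dist H e f"
begin

lemma class_bound: "i < 6 \<Longrightarrow> i \<noteq> 0 \<Longrightarrow> 2 \<le> ([1] @ replicate 4 2 @ [7] :: nat list) ! i"
  by (auto simp: less_Suc_eq numeral_eq_Suc)

lemma col_meet:
  assumes "e \<in> edges H" "f \<in> edges H" "e \<noteq> f" "e \<inter> f \<noteq> {}"
  shows "col e \<noteq> col f"
proof
  assume "col e = col f"
  then have "enat (([1] @ replicate 4 2 @ [7]) ! col e + 1) \<le> enat (Suc 0)"
    using col_dist edge_dist_meet assms order_trans by blast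
  then show False
    using class_bound[OF col_less[OF assms(1)]] by (cases "col e = 0") auto
qed

text \<open>The path through \<open>g\<close> has length two, whereas every class of nonzero index
  demands distance at least three.\<close>

lemma col_near:
  assumes "e \<in> edges H" "f \<in> edges H" "g \<in> edges H" "e \<noteq> f" "e \<inter> g \<noteq> {}" "g \<inter> f \<noteq> {}"
  shows "compat (col e) (col f)"
proof (rule ccontr)
  assume "\<not> compat (col e) (col f)"
  then have *: "col e = col f" "col e \<noteq> 0"
    by (auto simp: compat_def)
  have "enat (([1] @ replicate 4 2 @ [7]) ! col e + 1) \<le> edge_dist H e f"
    by (rule col_dist[OF assms(1,2,4) *(1)])
  also have "\<dots> \<le> enat (Suc (Suc 0))"
    by (rule edge_dist_step[OF edge_dist_meet[OF assms(1,3,5)] assms(3,2,6)])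
  finally have "([1] @ replicate 4 2 @ [7]) ! col e + 1 \<le> Suc (Suc 0)"
    by simp
  then show False
    using class_bound[OF col_less[OF assms(1)] *(2)] by simp
qed

lemma col_5_dist:
  assumes "e \<in> edges H" "f \<in> edges H" "e \<noteq> f" "col e = 5" "col f = 5"
    and "edge_dist H e f \<le> enat n"
  shows "8 \<le> n"
proof -
  have "enat 8 \<le> edge_dist H e f"
    using col_dist[of e f] assms(1-5) by (simp add: numeral_eq_Suc)
  then have "enat 8 \<le> enat n"
    using assms(6) by (rule order_trans)
  then show ?thesis
    by simp
qed

end

section \<open>Distances and colors in a copy of \<open>L_graph\<close> with a pendant edge\<close>

locale pendant_L =
  fixes H :: "'a graph" and w :: 'a and \<phi> :: "xvert \<Rightarrow> 'a"
  assumes inj: "inj \<phi>"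
    and root: "w \<notin> range \<phi>"
    and pendant: "{w, \<phi> X1} \<in> edges H"
    and copy: "e \<in> edges L_graph \<Longrightarrow> \<phi> ` e \<in> edges H"
begin

definition branch :: "'a set set" where
  "branch = insert {w, \<phi> X1} ((`) \<phi> ` edges L_graph)"

definition far_triangle :: "'a set set" where
  "far_triangle = {{\<phi> X6, \<phi> X7}, {\<phi> X6, \<phi> X8}, {\<phi> X7, \<phi> X8}}"

lemma branch_eq: "branch = {{w, \<phi> X1}, {\<phi> X1, \<phi> X2}, {\<phi> X1, \<phi> X3}, {\<phi> X2, \<phi> X3},
    {\<phi> X2, \<phi> X4}, {\<phi> X3, \<phi> X5}, {\<phi> X4, \<phi> X5}, {\<phi> X4, \<phi> X6}, {\<phi> X5, \<phi> X7}} \<union> far_triangle"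
  unfolding branch_def far_triangle_def L_graph_def by auto

lemma branch_subset: "branch \<subseteq> edges H"
  using pendant copy by (auto simp: branch_def)

lemmas branch_edges = branch_subset[unfolded branch_eq far_triangle_def Un_subset_iff insert_subset]

text \<open>Edges are reached layer by layer from the pendant edge, and the last layer is
  \<open>far_triangle\<close>. Only upper bounds are derived, so the rest of \<open>H\<close> can be
  arbitrary.\<close>

lemma edge_dist_pendant:
  shows edge_dist_pendant_far: "e \<in> branch \<Longrightarrow> edge_dist H {w, \<phi> X1} e \<le> enat 4"
    and edge_dist_pendant_near:
      "e \<in> branch - far_triangle \<Longrightarrow> edge_dist H {w, \<phi> X1} e \<le> enat 3"
proof -
  let ?d = "edge_dist H {w, \<phi> X1}"
  have 1: "?d {w, \<phi> X1} \<le> enat (Suc 0)" "?d {\<phi> X1, \<phi> X2} \<le> enat (Suc 0)"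
      "?d {\<phi> X1, \<phi> X3} \<le> enat (Suc 0)"
    using branch_edges by (auto intro!: edge_dist_meet)
  have 2: "?d {\<phi> X2, \<phi> X3} \<le> enat 2" "?d {\<phi> X2, \<phi> X4} \<le> enat 2" "?d {\<phi> X3, \<phi> X5} \<le> enat 2"
    using edge_dist_step[OF 1(2)] edge_dist_step[OF 1(3)] branch_edges
    by (auto simp: numeral_2_eq_2)
  have 3: "?d {\<phi> X4, \<phi> X5} \<le> enat 3" "?d {\<phi> X4, \<phi> X6} \<le> enat 3" "?d {\<phi> X5, \<phi> X7} \<le> enat 3"
    using edge_dist_step[OF 2(2)] edge_dist_step[OF 2(3)] branch_edges
    by (auto simp: numeral_3_eq_3 numeral_2_eq_2)
  have 4: "?d {\<phi> X6, \<phi> X7} \<le> enat 4" "?d {\<phi> X6, \<phi> X8} \<le> enat 4" "?d {\<phi> X7, \<phi> X8} \<le> enat 4"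
    using edge_dist_step[OF 3(2)] edge_dist_step[OF 3(3)] branch_edges
    by (auto simp: eval_nat_numeral)
  have mono: "?d e \<le> enat m \<Longrightarrow> m \<le> n \<Longrightarrow> ?d e \<le> enat n" for e m n
    by (metis enat_ord_simps(1) order_trans)
  show near: "?d e \<le> enat 3" if "e \<in> branch - far_triangle" for e
    using that 1[THEN mono, of 3] 2[THEN mono, of 3] 3 unfolding branch_eq by auto
  show "?d e \<le> enat 4" if "e \<in> branch" for e
  proof (cases "e \<in> far_triangle")
    case True
    then show ?thesis using 4 by (auto simp: far_triangle_def)
  next
    case False
    then show ?thesis using near[of e, THEN mono, of 4] that by simp
  qed
qed

lemma edge_dist_far_triangle:
  assumes "{\<phi> X8, y} \<in> edges H" "e \<in> far_triangle"
  shows "edge_dist H {\<phi> X8, y} e \<le> enat 2"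
proof -
  \<comment> \<open>This triangle edge meets \<open>{\<phi> X8, y}\<close> and every edge of the
    triangle.\<close>
  have "edge_dist H {\<phi> X8, y} {\<phi> X6, \<phi> X8} \<le> enat (Suc 0)"
    using assms branch_edges by (auto intro!: edge_dist_meet)
  from edge_dist_step[OF this, of e] show ?thesis
    using assms branch_edges by (auto simp: far_triangle_def numeral_2_eq_2)
qed

text \<open>This is used to see that edges taken from different branches are distinct, as
  \<open>col_5_dist\<close> requires.\<close>

lemma branch_vertices: "e \<in> branch \<Longrightarrow> e \<subseteq> insert w (range \<phi>) \<and> e \<inter> range \<phi> \<noteq> {}"
  unfolding branch_eq far_triangle_def by auto

text \<open>Otherwise all twelve edges of the branch have colors below 5 and the pendant edge has a
  nonzero one. Then \<open>two_zeros\<close> leaves three cases, each excluded by one of the two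
  \<open>no_coloring\<close> lemmas.\<close>

lemma pendant_col_0_or_col_5:
  assumes "packing_147 H col"
  shows "col {w, \<phi> X1} = 0 \<or> (\<exists>e\<in>branch. col e = 5)"
proof (rule ccontr)
  assume contra: "\<not> ?thesis"
  interpret packing_147 H col by fact
  have distinct_vertices: "\<phi> x = \<phi> y \<longleftrightarrow> x = y" "w \<noteq> \<phi> x" "\<phi> x \<noteq> w" for x y
    using inj root by (auto simp: inj_eq)
  have less: "col e < 5" if "e \<in> branch" for e
    using col_less[of e] branch_subset contra that by force
  note simps = doubleton_eq_iff distinct_vertices
  have meet: "col {x, y} \<noteq> col {x', y'}"
    if "{x, y} \<in> edges H" "{x', y'} \<in> edges H" "{x, y} \<noteq> {x', y'}" "{x, y} \<inter> {x', y'} \<noteq> {}"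
    for x y x' y' using col_meet that .
  let ?p = "col {w, \<phi> X1}" and ?c = "\<lambda>x y. col {\<phi> x, \<phi> y}"
  have ne: "?p \<noteq> ?c X1 X2" "?p \<noteq> ?c X1 X3"
      "?c X1 X2 \<noteq> ?c X1 X3" "?c X1 X2 \<noteq> ?c X2 X3" "?c X1 X2 \<noteq> ?c X2 X4"
      "?c X1 X3 \<noteq> ?c X2 X3" "?c X1 X3 \<noteq> ?c X3 X5"
      "?c X2 X3 \<noteq> ?c X2 X4" "?c X2 X3 \<noteq> ?c X3 X5"
      "?c X4 X5 \<noteq> ?c X2 X4" "?c X4 X5 \<noteq> ?c X3 X5"
      "?c X4 X6 \<noteq> ?c X2 X4" "?c X4 X6 \<noteq> ?c X4 X5"
      "?c X5 X7 \<noteq> ?c X3 X5" "?c X5 X7 \<noteq> ?c X4 X5"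
      "?c X6 X7 \<noteq> ?c X4 X6" "?c X6 X7 \<noteq> ?c X5 X7"
      "?c X6 X8 \<noteq> ?c X4 X6" "?c X6 X8 \<noteq> ?c X6 X7"
      "?c X7 X8 \<noteq> ?c X5 X7" "?c X7 X8 \<noteq> ?c X6 X7" "?c X7 X8 \<noteq> ?c X6 X8"
    using branch_edges by (intro meet; simp add: simps)+
  \<comment> \<open>The edge \<open>{x, y}\<close> plays the role of the middle edge
    \<open>g\<close> in \<open>col_near\<close>.\<close>
  have near: "compat (col e) (col f)"
    if "e \<in> edges H" "f \<in> edges H" "e \<noteq> f" "\<exists>x\<in>e. \<exists>y\<in>f. {x, y} \<in> edges H" for e f
    using that col_near by (metis IntI empty_iff insertCI)
  have compat: "compat ?p (?c X2 X3)" "compat ?p (?c X2 X4)" "compat ?p (?c X3 X5)"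
      "compat (?c X1 X2) (?c X3 X5)" "compat (?c X1 X3) (?c X2 X4)" "compat (?c X2 X4) (?c X3 X5)"
      "compat (?c X4 X5) (?c X1 X2)" "compat (?c X4 X5) (?c X1 X3)" "compat (?c X4 X5) (?c X2 X3)"
      "compat (?c X4 X6) (?c X2 X3)" "compat (?c X4 X6) (?c X3 X5)" "compat (?c X4 X6) (?c X5 X7)"
      "compat (?c X5 X7) (?c X2 X3)" "compat (?c X5 X7) (?c X2 X4)" "compat (?c X5 X7) (?c X4 X6)"
      "compat (?c X6 X7) (?c X2 X4)" "compat (?c X6 X7) (?c X3 X5)" "compat (?c X6 X7) (?c X4 X5)"
      "compat (?c X6 X8) (?c X2 X4)" "compat (?c X6 X8) (?c X4 X5)" "compat (?c X6 X8) (?c X5 X7)"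
      "compat (?c X7 X8) (?c X3 X5)" "compat (?c X7 X8) (?c X4 X5)" "compat (?c X7 X8) (?c X4 X6)"
    using branch_edges by (intro near; simp add: simps insert_commute)+
  have lt: "?p < 5" "?c X1 X2 < 5" "?c X1 X3 < 5" "?c X2 X3 < 5" "?c X2 X4 < 5" "?c X3 X5 < 5"
      "?c X4 X5 < 5" "?c X4 X6 < 5" "?c X5 X7 < 5" "?c X6 X7 < 5" "?c X6 X8 < 5" "?c X7 X8 < 5"
    by (intro less; simp add: branch_eq far_triangle_def)+
  have "?p \<noteq> 0"
    using contra by simp
  show False
  proof (rule two_zeros[OF lt(1-6) \<open>?p \<noteq> 0\<close> ne(1-2) compat(1-3) ne(3-5) compat(4)
        ne(6) compat(5) ne(7-9) compat(6)])
    assume zeros: "?c X1 X2 = 0" "?c X3 X5 = 0" "distinct [0, ?p, ?c X1 X3, ?c X2 X3, ?c X2 X4]"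
    show False
      by (rule no_coloring_12_35[OF _ _ _ _ _ _ _ _ _ zeros(2,3), where ?a45.0 = "?c X4 X5"
            and ?a57.0 = "?c X5 X7" and ?a46.0 = "?c X4 X6" and ?a67.0 = "?c X6 X7"
            and ?a68.0 = "?c X6 X8"]) (fact lt ne compat)+
  next
    \<comment> \<open>This is the mirror image of the first case under the automorphism of
      \<open>L_graph\<close> that swaps \<open>X2\<close> with \<open>X3\<close>, \<open>X4\<close>
      with \<open>X5\<close> and \<open>X6\<close> with \<open>X7\<close>; the instantiation below
      is permuted accordingly.\<close>
    assume zeros: "?c X1 X3 = 0" "?c X2 X4 = 0" "distinct [0, ?p, ?c X1 X2, ?c X2 X3, ?c X3 X5]"
    show False
      by (rule no_coloring_12_35[OF _ _ _ _ _ _ _ _ _ zeros(2,3), where ?a45.0 = "?c X4 X5"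
            and ?a57.0 = "?c X4 X6" and ?a46.0 = "?c X5 X7" and ?a67.0 = "?c X6 X7"
            and ?a68.0 = "?c X7 X8"]) (fact lt ne[symmetric] ne compat)+
  next
    assume zeros: "?c X2 X4 = 0" "?c X3 X5 = 0" "distinct [0, ?p, ?c X1 X2, ?c X1 X3, ?c X2 X3]"
    show False
      by (rule no_coloring_24_35[OF _ _ _ _ _ _ _ _ _ _ zeros, where ?a45.0 = "?c X4 X5"
            and ?a57.0 = "?c X5 X7" and ?a46.0 = "?c X4 X6" and ?a67.0 = "?c X6 X7"
            and ?a68.0 = "?c X6 X8" and ?a78.0 = "?c X7 X8"]) (fact lt ne compat)+
  qed
qed

end

section \<open>The graph G\<close>

lemma pendant_L_U: "pendant_L G_graph U (UL c)"
  by unfold_locales (auto simp: G_graph_def inj_def)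

lemma gadget_edge: "e \<in> edges gadget_graph \<Longrightarrow> GV c ` e \<in> edges G_graph"
  unfolding G_graph_def graph.simps
  by (rule UnI1, rule UnI1, rule UnI2, rule UN_I, rule UNIV_I, rule imageI)

lemma pendant_L_GV: "pendant_L G_graph (GV c V) (\<lambda>x. GV c (VL b x))"
proof
  fix e assume "e \<in> edges L_graph"
  then have "VL b ` e \<in> edges gadget_graph"
    by (auto simp: gadget_graph_def)
  from gadget_edge[OF this] show "(\<lambda>x. GV c (VL b x)) ` e \<in> edges G_graph"
    by (simp add: image_image)
next
  have "{V, VL b X1} \<in> edges gadget_graph"
    by (auto simp: gadget_graph_def)
  from gadget_edge[OF this] show "{GV c V, GV c (VL b X1)} \<in> edges G_graph"
    by simp
qed (auto simp: inj_def)

lemma edge_UL_GV: "{UL c X8, GV c V} \<in> edges G_graph"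
  by (auto simp: G_graph_def)

lemma packing_147_of_packing_edge_coloring:
  assumes "packing_edge_coloring ([1] @ replicate 4 2 @ [7]) H C"
  obtains col where "packing_147 H col"
proof -
  let ?S = "[1] @ replicate 4 2 @ [7] :: nat list"
  have "\<exists>i<6. e \<in> C i" if "e \<in> edges H" for e
    using that assms unfolding packing_edge_coloring_def by auto
  then obtain col where col: "\<And>e. e \<in> edges H \<Longrightarrow> col e < 6 \<and> e \<in> C (col e)"
    by metis
  have "enat (?S ! i + 1) \<le> edge_dist H e f" if "i < 6" "e \<in> C i" "f \<in> C i" "e \<noteq> f" for i e f
    using that assms unfolding packing_edge_coloring_def by simp
  then have "packing_147 H col"
    using col by unfold_locales metis+
  then show thesis
    by (rule that)
qed

theorem mainTheorem8:
  "\<not> (\<exists>C. packing_edge_coloring ([1] @ replicate 4 2 @ [7]) G_graph C)"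
proof
  assume "\<exists>C. packing_edge_coloring ([1] @ replicate 4 2 @ [7]) G_graph C"
  then obtain col where packing: "packing_147 G_graph col"
    using packing_147_of_packing_edge_coloring by blast
  interpret packing_147 G_graph col by fact
  interpret up: pendant_L G_graph U "UL c" for c
    by (rule pendant_L_U)
  interpret down: pendant_L G_graph "GV c V" "\<lambda>x. GV c (VL b x)" for c b
    by (rule pendant_L_GV)
  \<comment> \<open>The two pendant edges meet at \<open>U\<close>, so they cannot both have color
    0.\<close>
  have up5: "(\<exists>e\<in>up.branch c. col e = 5) \<or> (\<exists>e\<in>up.branch c'. col e = 5)" if "c \<noteq> c'" for c c'
    using up.pendant_col_0_or_col_5[OF packing, of c] up.pendant_col_0_or_col_5[OF packing, of c']
      col_meet[OF up.pendant up.pendant, of c c'] that by (auto simp: doubleton_eq_iff)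
  have down5: "\<exists>b. \<exists>f\<in>down.branch c b. col f = 5" for c
    using down.pendant_col_0_or_col_5[OF packing, of c Plain2]
      down.pendant_col_0_or_col_5[OF packing, of c Prime2]
      col_meet[OF down.pendant down.pendant, of c Plain2 c Prime2] by (auto simp: doubleton_eq_iff)
  have not_far: "e \<notin> up.far_triangle c" if "e \<in> up.branch c" "col e = 5" for c e
  proof
    assume e: "e \<in> up.far_triangle c"
    obtain b f where f: "f \<in> down.branch c b" "col f = 5"
      using down5 by blast
    \<comment> \<open>At most 2 from \<open>e\<close> to the edge joining \<open>UL c X8\<close> to
      \<open>GV c V\<close>, one step to the pendant edge of the gadget branch, and at most 4 on to
      \<open>f\<close>: 7 in all, below the required 8.\<close>
    have "edge_dist G_graph e f \<le> enat (Suc 2 + 4)"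
      using up.edge_dist_far_triangle[OF edge_UL_GV e] down.edge_dist_pendant_far[OF f(1)]
      by (rule edge_dist_bridge) (use edge_UL_GV down.pendant in auto)
    moreover have "e \<noteq> f"
      using up.branch_vertices[OF that(1)] down.branch_vertices[OF f(1)] by auto
    ultimately show False
      using col_5_dist[of e f] that f up.branch_subset down.branch_subset by fastforce
  qed
  \<comment> \<open>By \<open>up5\<close> at most one of the three branches at \<open>U\<close>
    lacks color 5.\<close>
  obtain c c' e e' where "c \<noteq> c'" and e: "e \<in> up.branch c" "col e = 5"
      and e': "e' \<in> up.branch c'" "col e' = 5"
    using up5[of Plain Prime] up5[of Plain Second] up5[of Prime Second] by blast
  \<comment> \<open>By \<open>not_far\<close> the sharper bound 3 holds on both sides. With the
    general bound 4 on either side the total would be at least 8, and no contradiction would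
    result.\<close>
  have "edge_dist G_graph e e' \<le> enat (Suc 3 + 3)"
    by (rule edge_dist_bridge[OF up.edge_dist_pendant_near up.edge_dist_pendant_near])
      (use not_far e e' up.pendant in auto)
  moreover have "e \<noteq> e'"
    using up.branch_vertices[OF e(1)] up.branch_vertices[OF e'(1)] \<open>c \<noteq> c'\<close> by auto
  ultimately show False
    using col_5_dist[of e e'] e e' up.branch_subset by fastforce
qed

end
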